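(* Let $G$ be a Lie group whose Lie algebra $\mathfrak g$ carries a symmetric non-degenerate pairing $\langle\cdot,\cdot\rangle$ with $\langle[a,b],c\rangle+\langle b,[a,c]\rangle=0$ for all $a,b,c\in\mathfrak g$. Let $(\mathbb G_\bullet,\omega_S)$ be the $2$-shifted symplectic Lie $2$-group $L_1G\to P_1G\to\ast$ with Segal $2$-form $\omega_S\in\Omega^2(L_1G)$, let $ev_1:P_0\mathfrak g\to\mathfrak g$, $ev_1(\alpha)=\alpha(1)$, and let $\Phi$ be the van Est map. Then $$\Phi(\omega_S)=ev_1^*\langle\cdot,\cdot\rangle,$$ that is, $\Phi(\omega_S)(\alpha,\beta)=\langle\alpha(1),\beta(1)\rangle$ for all $\alpha,\beta\in P_0\mathfrak g$.
   Context: $P_1G$ is the space of paths $[0,1]\to G$ of a fixed Sobolev class $r$ starting at the identity; $L_1G$ is the based loop group of loops in $G$ of Sobolev class $r$ starting at the identity; $P_0\mathfrak g$, $L_0\mathfrak g$ are the analogous spaces of paths and loops in $\mathfrak g$ starting at $0$. $\mathbb G_\bullet$ is a Lie 2-group with $\mathbb G_0=\ast$, $\mathbb G_1=P_1G$, $\mathbb G_2=L_1G$, whose Lie 2-algebra is $\ell_1:L_0\mathfrak g\to P_0\mathfrak g$ (natural inclusion, pointwise bracket). Its degeneracies $\sigma_0,\sigma_1:P_1G\to L_1G$ are $$(\sigma_0\gamma)(\tau)=\begin{cases}\gamma(3\tau)&\tau\in[0,\frac13]\\\gamma(1)&\tau\in[\frac13,\frac23]\\\gamma(3-3\tau)&\tau\in[\frac23,1],\end{cases}\qquad(\sigma_1\gamma)(\tau)=\begin{cases}1&\tau\in[0,\frac13]\\\gamma(3\tau-1)&\tau\in[\frac13,\frac23]\\\gamma(3-3\tau)&\tau\in[\frac23,1].\end{cases}$$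 The Segal $2$-form is, for $\lambda\in L_1G$ and $a,b\in T_\lambda L_1G$, $$(\omega_S)_\lambda(a,b)=\int_{S^1}\Big\langle\frac{d}{d\tau}\big(dL_{\lambda(\tau)}^{-1}a(\tau)\big),\ dL_{\lambda(\tau)}^{-1}b(\tau)\Big\rangle d\tau,$$ with $S^1=[0,1]/(0\sim1)$. The van Est map sends a normalized $r$-form on level $p$ of the Lie 2-group to elements of the Weil algebra of its Lie 2-algebra $\mathfrak h\to\mathfrak g_0$ with components in $\bigwedge^k\mathfrak g_0^*\otimes\mathrm{Sym}^l\mathfrak h^*\otimes\mathrm{Sym}^a\mathfrak g_0^*\otimes\bigwedge^b\mathfrak h^*$, $k+2l+a+2b=p$, $a+b=r$. Here $p=r=2$, $\mathfrak g_0=P_0\mathfrak g$, $\mathfrak h=L_0\mathfrak g$, so the only component is $\Phi^{0020}\omega_S\in\mathrm{Sym}^2(P_0\mathfrak g)^*$, given by $(\Phi^{0020}\omega_S)(\alpha,\beta)=J_\alpha J_\beta\omega_S+J_\beta J_\alpha\omega_S$, where $J_\alpha\omega$ is the contraction of $\omega$ with the infinitesimal generator of $\alpha$ for the left action on the nerve, followed by pullback along $\sigma_0$. Concretely, with $\overline 1\in L_1G$ the constant loop, $$(\Phi^{0020}\omega_S)(\alpha,\beta)=(\omega_S)_{\overline1}(T\sigma_1(\alpha),T\sigma_0(\beta))+(\omega_S)_{\overline1}(T\sigma_1(\beta),T\sigma_0(\alpha)).$$ *)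

theory Defs
  imports "HOL-Analysis.Analysis" "HOL-Algebra.Group"
begin

section \<open>Smooth manifolds and Lie groups\<close>

fun Ck_on :: "nat \<Rightarrow> 'a::euclidean_space set \<Rightarrow> ('a \<Rightarrow> 'b::euclidean_space) \<Rightarrow> bool" where
  "Ck_on 0 S f = continuous_on S f"
| "Ck_on (Suc k) S f =
    ((\<forall>x\<in>S. f differentiable (at x)) \<and>
     (\<forall>v. Ck_on k S (\<lambda>x. frechet_derivative f (at x) v)))"

text \<open>Only used for open \<open>S\<close>.\<close>

definition smooth_on :: "'a::euclidean_space set \<Rightarrow> ('a \<Rightarrow> 'b::euclidean_space) \<Rightarrow> bool" where
  "smooth_on S f \<longleftrightarrow> (\<forall>k. Ck_on k S f)"

type_synonym ('m, 'v) chart = "'m set \<times> ('m \<Rightarrow> 'v)"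

definition smooth_atlas :: "'m topology \<Rightarrow> ('m, 'v::euclidean_space) chart set \<Rightarrow> bool" where
  "smooth_atlas X A \<longleftrightarrow>
     (\<Union>(U, \<phi>)\<in>A. U) = topspace X \<and>
     (\<forall>(U, \<phi>)\<in>A. openin X U \<and> open (\<phi> ` U) \<and>
        homeomorphic_map (subtopology X U) (top_of_set (\<phi> ` U)) \<phi>) \<and>
     (\<forall>(U, \<phi>)\<in>A. \<forall>(V, \<psi>)\<in>A. smooth_on (\<phi> ` (U \<inter> V)) (\<psi> \<circ> inv_into U \<phi>))"

definition prod_atlas ::
  "('m, 'v) chart set \<Rightarrow> ('n, 'w) chart set \<Rightarrow> ('m \<times> 'n, 'v \<times> 'w) chart set" where
  "prod_atlas A B = {(U \<times> V, map_prod \<phi> \<psi>) | U \<phi> V \<psi>. (U, \<phi>) \<in> A \<and> (V, \<psi>) \<in> B}"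

definition smooth_map ::
  "'m topology \<Rightarrow> ('m, 'v::euclidean_space) chart set \<Rightarrow>
   'n topology \<Rightarrow> ('n, 'w::euclidean_space) chart set \<Rightarrow> ('m \<Rightarrow> 'n) \<Rightarrow> bool" where
  "smooth_map X A Y B f \<longleftrightarrow> continuous_map X Y f \<and>
     (\<forall>(U, \<phi>)\<in>A. \<forall>(V, \<psi>)\<in>B.
        smooth_on (\<phi> ` {p \<in> U. f p \<in> V}) (\<psi> \<circ> f \<circ> inv_into U \<phi>))"

text \<open>
  Every point \<open>p\<close> gets a preferred chart, and the tangent space \<open>T\<^sub>p\<close> is the model space
  \<open>'v\<close>: a tangent vector at \<open>p\<close> is represented by its coordinates in the preferred chart at \<open>p\<close>.
\<close>

definition chart_at :: "('m, 'v) chart set \<Rightarrow> 'm \<Rightarrow> ('m, 'v) chart" where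
  "chart_at A p = (SOME c. c \<in> A \<and> p \<in> fst c)"

definition coord :: "('m, 'v) chart set \<Rightarrow> 'm \<Rightarrow> 'm \<Rightarrow> 'v" where
  "coord A p = snd (chart_at A p)"

definition coord_inv :: "('m, 'v) chart set \<Rightarrow> 'm \<Rightarrow> 'v \<Rightarrow> 'm" where
  "coord_inv A p = inv_into (fst (chart_at A p)) (coord A p)"

definition tangent_map ::
  "('m, 'v::euclidean_space) chart set \<Rightarrow> ('n, 'w::euclidean_space) chart set \<Rightarrow>
   ('m \<Rightarrow> 'n) \<Rightarrow> 'm \<Rightarrow> 'v \<Rightarrow> 'w" where
  "tangent_map A B f p =
     frechet_derivative (coord B (f p) \<circ> f \<circ> coord_inv A p) (at (coord A p p))"

locale lie_group = group G for G :: "('g, 'x) monoid_scheme" (structure) +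
  fixes X :: "'g topology" and A :: "('g, 'v::euclidean_space) chart set"
  assumes topspace_eq: "topspace X = carrier G"
    and Hausdorff: "Hausdorff_space X"
    and second_countable: "second_countable X"
    and atlas: "smooth_atlas X A"
    and smooth_mult:
      "smooth_map (prod_topology X X) (prod_atlas A A) X A (\<lambda>(x, y). x \<otimes> y)"
    and smooth_inv: "smooth_map X A X A (\<lambda>x. m_inv G x)"

text \<open>The Lie algebra is \<open>T\<^sub>1G\<close>, i.e. \<open>'v\<close>, with \<open>[u, v] = d/ds Ad(c(s)) v\<close> at \<open>s = 0\<close> for any
  curve \<open>c\<close> with \<open>c(0) = 1\<close> and \<open>c'(0) = u\<close>.\<close>

definition Ad :: "('g, 'x) monoid_scheme \<Rightarrow> ('g, 'v::euclidean_space) chart set \<Rightarrow>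
    'g \<Rightarrow> 'v \<Rightarrow> 'v" where
  "Ad G A g = tangent_map A A (\<lambda>x. g \<otimes>\<^bsub>G\<^esub> x \<otimes>\<^bsub>G\<^esub> m_inv G g) \<one>\<^bsub>G\<^esub>"

definition lie_bracket :: "('g, 'x) monoid_scheme \<Rightarrow> ('g, 'v::euclidean_space) chart set \<Rightarrow>
    'v \<Rightarrow> 'v \<Rightarrow> 'v" where
  "lie_bracket G A u v =
     frechet_derivative (\<lambda>x. Ad G A (coord_inv A \<one>\<^bsub>G\<^esub> x) v) (at (coord A \<one>\<^bsub>G\<^esub> \<one>\<^bsub>G\<^esub>)) u"

definition invariant_pairing :: "('g, 'x) monoid_scheme \<Rightarrow> ('g, 'v::euclidean_space) chart set \<Rightarrow>
    ('v \<Rightarrow> 'v \<Rightarrow> real) \<Rightarrow> bool" where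
  "invariant_pairing G A B \<longleftrightarrow>
     bilinear B \<and>
     (\<forall>a b. B a b = B b a) \<and>
     (\<forall>a. (\<forall>b. B a b = 0) \<longrightarrow> a = 0) \<and>
     (\<forall>a b c. B (lie_bracket G A a b) c + B b (lie_bracket G A a c) = 0)"

section \<open>Sobolev paths and loops\<close>

text \<open>
  \<open>H\<^sup>k\<close> on \<open>[a, b]\<close>, for \<open>k > 0\<close> in terms of the continuous representative: \<open>f\<close> is the indefinite
  integral of its weak derivative \<open>g\<close>, which is of class \<open>H\<close> of order \<open>k - 1\<close>.  On a bounded
  interval \<open>L\<^sup>2\<close> is contained in \<open>L\<^sup>1\<close>, so for \<open>k = 0\<close> this is membership in \<open>L\<^sup>2\<close>.
\<close>

fun sobolev :: "nat \<Rightarrow> real \<Rightarrow> real \<Rightarrow> (real \<Rightarrow> 'v::euclidean_space) \<Rightarrow> bool" where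
  "sobolev 0 a b f =
     (f absolutely_integrable_on {a..b} \<and>
      (\<lambda>t. (norm (f t))\<^sup>2) absolutely_integrable_on {a..b})"
| "sobolev (Suc k) a b f =
     (\<exists>g. sobolev k a b g \<and> (\<forall>t\<in>{a..b}. (g has_integral (f t - f a)) {a..t}))"

text \<open>
  Paths are continuous and piecewise of class \<open>H\<^sup>r\<close>.  Concatenations such as the degeneracies below
  have kinks, so for \<open>r > 1\<close> the spaces are closed under them only in the piecewise sense; for
  \<open>r = 1\<close> piecewise \<open>H\<^sup>1\<close> together with continuity is \<open>H\<^sup>1\<close>.
\<close>

definition pw_sobolev :: "nat \<Rightarrow> real \<Rightarrow> real \<Rightarrow> (real \<Rightarrow> 'v::euclidean_space) \<Rightarrow> bool" where
  "pw_sobolev r a b f \<longleftrightarrow> continuous_on {a..b} f \<and>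
     (\<exists>S. finite S \<and>
        (\<forall>c d. a \<le> c \<and> c < d \<and> d \<le> b \<and> {c<..<d} \<inter> S = {} \<longrightarrow> sobolev r c d f))"

definition weak_deriv :: "(real \<Rightarrow> 'v::euclidean_space) \<Rightarrow> real \<Rightarrow> 'v" where
  "weak_deriv f = (SOME g. g absolutely_integrable_on {0..1} \<and>
     (\<forall>t\<in>{0..1}. (g has_integral (f t - f 0)) {0..t}))"

text \<open>Paths are functions on \<open>real\<close> of which only the values on \<open>[0, 1]\<close> matter.\<close>

definition path_group :: "('g, 'x) monoid_scheme \<Rightarrow> 'g topology \<Rightarrow>
    ('g, 'v::euclidean_space) chart set \<Rightarrow> nat \<Rightarrow> (real \<Rightarrow> 'g) set" where
  "path_group G X A r = {\<gamma>. continuous_map (top_of_set {0..1}) X \<gamma> \<and>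
     (\<forall>(U, \<phi>)\<in>A. \<forall>c d. 0 \<le> c \<and> c < d \<and> d \<le> 1 \<and> \<gamma> ` {c..d} \<subseteq> U \<longrightarrow> pw_sobolev r c d (\<phi> \<circ> \<gamma>)) \<and>
     \<gamma> 0 = \<one>\<^bsub>G\<^esub>}"

definition loop_group :: "('g, 'x) monoid_scheme \<Rightarrow> 'g topology \<Rightarrow>
    ('g, 'v::euclidean_space) chart set \<Rightarrow> nat \<Rightarrow> (real \<Rightarrow> 'g) set" where
  "loop_group G X A r = {\<gamma> \<in> path_group G X A r. \<gamma> 1 = \<one>\<^bsub>G\<^esub>}"

definition path_algebra :: "nat \<Rightarrow> (real \<Rightarrow> 'v::euclidean_space) set" where
  "path_algebra r = {\<alpha>. pw_sobolev r 0 1 \<alpha> \<and> \<alpha> 0 = 0}"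

text \<open>
  Elements of \<open>T\<^sub>\<eta>(L\<^sub>1G)\<close> are the vector fields \<open>a\<close> along \<open>\<eta>\<close> of class \<open>r\<close> that vanish at the
  endpoints.  The value \<open>a(\<tau>)\<close> is given in the preferred chart at \<open>\<eta>(\<tau>)\<close>, which jumps with \<open>\<tau>\<close>;
  regularity is therefore tested after passing to a fixed chart.
\<close>

definition loop_tangent_space :: "('g, 'v::euclidean_space) chart set \<Rightarrow> nat \<Rightarrow>
    (real \<Rightarrow> 'g) \<Rightarrow> (real \<Rightarrow> 'v) set" where
  "loop_tangent_space A r \<eta> = {a.
     (\<forall>(U, \<phi>)\<in>A. \<forall>c d. 0 \<le> c \<and> c < d \<and> d \<le> 1 \<and> \<eta> ` {c..d} \<subseteq> U \<longrightarrow>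
        pw_sobolev r c d (\<lambda>\<tau>. frechet_derivative (\<phi> \<circ> coord_inv A (\<eta> \<tau>))
          (at (coord A (\<eta> \<tau>) (\<eta> \<tau>))) (a \<tau>))) \<and>
     a 0 = 0 \<and> a 1 = 0}"

section \<open>The Segal 2-form\<close>

text \<open>\<open>d(L\<^sub>g)\<inverse>\<close> from \<open>T\<^sub>gG\<close> to the Lie algebra, as the tangent map at \<open>g\<close> of left translation by
  the inverse of \<open>g\<close>.\<close>

definition left_triv :: "('g, 'x) monoid_scheme \<Rightarrow> ('g, 'v::euclidean_space) chart set \<Rightarrow>
    'g \<Rightarrow> 'v \<Rightarrow> 'v" where
  "left_triv G A g = tangent_map A A (\<lambda>x. m_inv G g \<otimes>\<^bsub>G\<^esub> x) g"

definition segal_form :: "('g, 'x) monoid_scheme \<Rightarrow> 'g topology \<Rightarrow>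
    ('g, 'v::euclidean_space) chart set \<Rightarrow> ('v \<Rightarrow> 'v \<Rightarrow> real) \<Rightarrow> nat \<Rightarrow>
    (real \<Rightarrow> 'g) \<Rightarrow> (real \<Rightarrow> 'v) \<Rightarrow> (real \<Rightarrow> 'v) \<Rightarrow> real" where
  "segal_form G X A B r \<eta> a b =
     (if \<eta> \<in> loop_group G X A r \<and> a \<in> loop_tangent_space A r \<eta> \<and> b \<in> loop_tangent_space A r \<eta>
      then integral {0..1} (\<lambda>\<tau>. B (weak_deriv (\<lambda>t. left_triv G A (\<eta> t) (a t)) \<tau>)
                                  (left_triv G A (\<eta> \<tau>) (b \<tau>)))
      else undefined)"

section \<open>Degeneracies and the van Est map\<close>

definition sigma0 :: "(real \<Rightarrow> 'g) \<Rightarrow> real \<Rightarrow> 'g" where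
  "sigma0 \<gamma> \<tau> = (if \<tau> \<le> 1/3 then \<gamma> (3 * \<tau>) else if \<tau> \<le> 2/3 then \<gamma> 1 else \<gamma> (3 - 3 * \<tau>))"

definition sigma1 :: "('g, 'x) monoid_scheme \<Rightarrow> (real \<Rightarrow> 'g) \<Rightarrow> real \<Rightarrow> 'g" where
  "sigma1 G \<gamma> \<tau> =
     (if \<tau> \<le> 1/3 then \<one>\<^bsub>G\<^esub> else if \<tau> \<le> 2/3 then \<gamma> (3 * \<tau> - 1) else \<gamma> (3 - 3 * \<tau>))"

definition const_loop :: "('g, 'x) monoid_scheme \<Rightarrow> real \<Rightarrow> 'g" where
  "const_loop G = (\<lambda>\<tau>. \<one>\<^bsub>G\<^esub>)"

text \<open>
  Tangent map at the constant path of a map \<open>F\<close> of path spaces with \<open>F(1) = 1\<close>.  Near the constant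
  path the path group has the chart \<open>\<gamma> \<mapsto> \<phi> \<circ> \<gamma> - \<phi>(1)\<close> with values in the path algebra, \<open>\<phi>\<close> being
  the preferred chart at \<open>1\<close>; so the tangent vector \<open>\<alpha>\<close> is the velocity of the curve
  \<open>s \<mapsto> \<phi>\<inverse>(\<phi>(1) + s \<alpha>)\<close> of paths, and the velocity of its image under \<open>F\<close> is read off in the same
  chart, at each \<open>\<tau>\<close>.
\<close>

definition path_tangent_map :: "('g, 'x) monoid_scheme \<Rightarrow> ('g, 'v::euclidean_space) chart set \<Rightarrow>
    ((real \<Rightarrow> 'g) \<Rightarrow> (real \<Rightarrow> 'g)) \<Rightarrow> (real \<Rightarrow> 'v) \<Rightarrow> real \<Rightarrow> 'v" where
  "path_tangent_map G A F \<alpha> \<tau> =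
     vector_derivative
       (\<lambda>s. coord A \<one>\<^bsub>G\<^esub>
          (F (\<lambda>t. coord_inv A \<one>\<^bsub>G\<^esub> (coord A \<one>\<^bsub>G\<^esub> \<one>\<^bsub>G\<^esub> + s *\<^sub>R \<alpha> t)) \<tau>))
       (at 0)"

text \<open>
  The van Est map on normalized 2-forms \<open>\<omega>\<close> on the loop group.  The component in degrees
  \<open>(k, l, a, b)\<close> requires \<open>k + 2l + a + 2b = 2\<close> and \<open>a + b = 2\<close>, so \<open>(0, 0, 2, 0)\<close>, a symmetric
  bilinear form on the path algebra, is the only one.
\<close>

definition van_est :: "('g, 'x) monoid_scheme \<Rightarrow> ('g, 'v::euclidean_space) chart set \<Rightarrow>
    ((real \<Rightarrow> 'g) \<Rightarrow> (real \<Rightarrow> 'v) \<Rightarrow> (real \<Rightarrow> 'v) \<Rightarrow> real) \<Rightarrow>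
    (real \<Rightarrow> 'v) \<Rightarrow> (real \<Rightarrow> 'v) \<Rightarrow> real" where
  "van_est G A \<omega> \<alpha> \<beta> =
     \<omega> (const_loop G) (path_tangent_map G A (sigma1 G) \<alpha>) (path_tangent_map G A sigma0 \<beta>) +
     \<omega> (const_loop G) (path_tangent_map G A (sigma1 G) \<beta>) (path_tangent_map G A sigma0 \<alpha>)"

definition ev1 :: "(real \<Rightarrow> 'v) \<Rightarrow> 'v" where
  "ev1 \<alpha> = \<alpha> 1"

end

theory Submission
  imports Defs
begin

text \<open>
  Left trivialization at the constant loop is the identity, so the form there is
  \<open>\<integral> B a' b\<close>.  For \<open>a = T\<sigma>\<^sub>1 \<alpha>\<close> and \<open>b = T\<sigma>\<^sub>0 \<beta>\<close> the first third
  contributes nothing because \<open>a\<close> vanishes there, and the middle third contributes \<open>B (\<alpha> 1) (\<beta> 1)\<close>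
  because \<open>b\<close> is constant there.  On the last third \<open>T\<sigma>\<^sub>0\<close> and \<open>T\<sigma>\<^sub>1\<close> agree, so after
  symmetrization integration by parts gives \<open>- B (\<alpha> 1) (\<beta> 1)\<close>, for a total of
  \<open>2 B (\<alpha> 1) (\<beta> 1) - B (\<alpha> 1) (\<beta> 1)\<close>.  Since weak derivatives are only determined almost
  everywhere, integration by parts is needed for absolutely continuous functions.
\<close>

section \<open>Absolutely continuous functions\<close>

text \<open>Absolute continuity with an explicit density \<open>f'\<close>. On \<open>{0..1}\<close>
  the body is the very predicate from which \<open>weak_deriv\<close> chooses, so that choice
  satisfies it as soon as some density exists.\<close>

definition weak_derivative_on ::
  "real \<Rightarrow> real \<Rightarrow> (real \<Rightarrow> 'v::euclidean_space) \<Rightarrow> (real \<Rightarrow> 'v) \<Rightarrow> bool" where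
  "weak_derivative_on a b f f' \<longleftrightarrow> f' absolutely_integrable_on {a..b} \<and>
     (\<forall>t\<in>{a..b}. (f' has_integral (f t - f a)) {a..t})"

lemma has_integral_increment:
  fixes f f' :: "real \<Rightarrow> 'v::euclidean_space"
  assumes "\<And>t. t \<in> {a..b} \<Longrightarrow> (f' has_integral (f t - f a)) {a..t}" "a \<le> s" "s \<le> t" "t \<le> b"
  shows "(f' has_integral (f t - f s)) {s..t}"
proof -
  have s: "(f' has_integral (f s - f a)) {a..s}" and t: "(f' has_integral (f t - f a)) {a..t}"
    by (intro assms(1); use assms(2-4) in simp)+
  have "f' integrable_on {s..t}"
    by (rule integrable_subinterval_real[OF has_integral_integrable[OF t]]) (use assms(2) in auto)
  then obtain i where i: "(f' has_integral i) {s..t}"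
    by blast
  have "(f' has_integral (f s - f a + i)) {a..t}"
    using has_integral_combine[OF assms(2,3) s i] .
  then have "f s - f a + i = f t - f a"
    using t has_integral_unique by blast
  then have "i = f t - f s"
    by (simp add: algebra_simps)
  with i show ?thesis by simp
qed

lemma weak_derivative_on_has_integral:
  assumes "weak_derivative_on a b f f'" "a \<le> s" "s \<le> t" "t \<le> b"
  shows "(f' has_integral (f t - f s)) {s..t}"
  by (rule has_integral_increment[of a b f' f]) (use assms in \<open>simp_all add: weak_derivative_on_def\<close>)

lemma weak_derivative_on_subinterval:
  assumes "weak_derivative_on a b f f'" "a \<le> c" "d \<le> b"
  shows "weak_derivative_on c d f f'"
  unfolding weak_derivative_on_def
proof (intro conjI ballI)
  show "f' absolutely_integrable_on {c..d}"
    using assms by (auto simp: weak_derivative_on_def intro: absolutely_integrable_on_subinterval)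
next
  fix t assume "t \<in> {c..d}"
  then show "(f' has_integral (f t - f c)) {c..t}"
    using weak_derivative_on_has_integral[OF assms(1), of c t] assms(2,3) by auto
qed

lemma weak_derivative_on_continuous:
  assumes "weak_derivative_on a b f f'"
  shows "continuous_on {a..b} f"
proof -
  have "f' integrable_on {a..b}"
    using assms by (auto simp: weak_derivative_on_def dest: set_lebesgue_integral_eq_integral(1))
  then have "continuous_on {a..b} (\<lambda>x. f a + integral {a..x} f')"
    by (intro continuous_intros indefinite_integral_continuous_1)
  then show ?thesis
    by (rule continuous_on_eq)
      (use assms in \<open>auto simp: weak_derivative_on_def has_integral_iff\<close>)
qed

lemma weak_derivative_on_combine:
  assumes f: "weak_derivative_on a m f f1" "weak_derivative_on m b f f2" and "a \<le> m" "m \<le> b"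
  shows "weak_derivative_on a b f (\<lambda>t. if t \<le> m then f1 t else f2 t)" (is "weak_derivative_on a b f ?g")
proof -
  have sub: "(?g has_integral (f t - f m)) {m..t}" if "m \<le> t" "t \<le> b" for t
  \<comment> \<open>At \<open>m\<close> itself the glued density takes the value of
    \<open>f1\<close>, not \<open>f2\<close>; one point does not affect the integral.\<close>
  proof (rule has_integral_spike_finite[of "{m}"])
    show "(f2 has_integral (f t - f m)) {m..t}"
      using f that by (auto simp: weak_derivative_on_def)
  qed auto
  have sub1: "(?g has_integral (f t - f a)) {a..t}" if "a \<le> t" "t \<le> m" for t
  proof (rule has_integral_spike_finite[of "{}"])
    show "(f1 has_integral (f t - f a)) {a..t}"
      using f that by (auto simp: weak_derivative_on_def)
  qed (use that in auto)
  have "?g absolutely_integrable_on {a..m}"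
    by (rule absolutely_integrable_spike[where f = f1 and S = "{}"]) (use f in \<open>auto simp: weak_derivative_on_def\<close>)
  moreover have "?g absolutely_integrable_on {m..b}"
    by (rule absolutely_integrable_spike[where f = f2 and S = "{m}"]) (use f in \<open>auto simp: weak_derivative_on_def\<close>)
  ultimately have "?g absolutely_integrable_on ({a..m} \<union> {m..b})"
    by (rule absolutely_integrable_Un)
  moreover have "{a..m} \<union> {m..b} = {a..b}"
    using assms by auto
  moreover have "(?g has_integral (f t - f a)) {a..t}" if "t \<in> {a..b}" for t
  proof (cases "t \<le> m")
    case True
    then show ?thesis using sub1 that by auto
  next
    case False
    then have "(?g has_integral ((f m - f a) + (f t - f m))) {a..t}"
      using has_integral_combine[OF _ _ sub1[of m] sub[of t]] that assms(3) by auto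
    then show ?thesis by (simp add: algebra_simps)
  qed
  ultimately show ?thesis
    by (auto simp: weak_derivative_on_def)
qed

section \<open>Integration by parts for weak derivatives\<close>

text \<open>Over pieces of equal \<open>m\<close>-increment the quadratic bounds add up to a
  quantity inversely proportional to the number of pieces. No pointwise derivative of
  \<open>H\<close> is involved.\<close>

lemma eq_if_quadratic_increments:
  fixes H :: "real \<Rightarrow> 'a::real_normed_vector" and m :: "real \<Rightarrow> real"
  assumes "a \<le> b" and cont: "continuous_on {a..b} m" and mono: "mono_on {a..b} m"
    and bound: "\<And>s t. a \<le> s \<Longrightarrow> s \<le> t \<Longrightarrow> t \<le> b \<Longrightarrow> norm (H t - H s) \<le> C * (m t - m s)\<^sup>2"
  shows "H b = H a"
proof -
  txt \<open>Bisecting \<open>{s..t}\<close> at the median of \<open>m\<close> halves the bound.\<close>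
  have *: "norm (H t - H s) \<le> C / 2 ^ n * (m t - m s)\<^sup>2" if "a \<le> s" "s \<le> t" "t \<le> b" for n s t
    using that
  proof (induction n arbitrary: s t)
    case 0
    then show ?case using bound by simp
  next
    case (Suc n)
    have le: "m s \<le> m t"
      using Suc.prems mono by (auto simp: mono_on_def)
    obtain u where u: "s \<le> u" "u \<le> t" "m u = (m s + m t) / 2"
      using IVT'[of m s "(m s + m t) / 2" t] le Suc.prems continuous_on_subset[OF cont, of "{s..t}"]
      by (auto simp: field_simps)
    have "norm (H t - H s) \<le> norm (H t - H u) + norm (H u - H s)"
      by (metis add.commute diff_add_cancel add_diff_eq norm_triangle_ineq)
    also have "\<dots> \<le> C / 2 ^ n * (m t - m u)\<^sup>2 + C / 2 ^ n * (m u - m s)\<^sup>2"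
      using Suc.IH[of u t] Suc.IH[of s u] Suc.prems u(1,2) by (intro add_mono) auto
    also have "\<dots> = C / 2 ^ Suc n * (m t - m s)\<^sup>2"
      unfolding u(3) by (simp add: field_simps power2_eq_square)
    finally show ?case .
  qed
  have "(\<lambda>n. C * (m b - m a)\<^sup>2 * (1 / 2) ^ n) \<longlonglongrightarrow> C * (m b - m a)\<^sup>2 * 0"
    by (intro tendsto_mult tendsto_const LIMSEQ_power_zero) auto
  moreover have "norm (H b - H a) \<le> C * (m b - m a)\<^sup>2 * (1 / 2) ^ n" for n
    using *[of a b n] \<open>a \<le> b\<close> by (simp add: field_simps)
  ultimately have "norm (H b - H a) \<le> 0"
    by (intro LIMSEQ_le_const) auto
  then show ?thesis by simp
qed

lemma bounded_bilinear_absolutely_integrable: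
  fixes B :: "'a::euclidean_space \<Rightarrow> 'b::euclidean_space \<Rightarrow> 'c::euclidean_space"
  assumes "bounded_bilinear B" "continuous_on {a..b} f" "g absolutely_integrable_on {a..b}"
  shows "(\<lambda>t. B (f t) (g t)) absolutely_integrable_on {a..b::real}"
proof (rule absolutely_integrable_bounded_measurable_product[where h = B])
  show "bilinear B"
    using assms by (simp add: bilinear_conv_bounded_bilinear)
  show "f \<in> borel_measurable (lebesgue_on {a..b})"
    using assms by (intro continuous_imp_measurable_on_sets_lebesgue) auto
  show "bounded (f ` {a..b})"
    using assms by (intro compact_imp_bounded compact_continuous_image) auto
qed (use assms in auto)

text \<open>The difference \<open>H\<close> between the product and the integral of the product-rule
  integrand has increments of second order in \<open>m\<close>, the integral of
  \<open>norm f' + norm g'\<close>. Hence \<open>eq_if_quadratic_increments\<close> applies.\<close>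

lemma integral_by_parts_weak_derivative:
  fixes B :: "'a::euclidean_space \<Rightarrow> 'b::euclidean_space \<Rightarrow> 'c::euclidean_space"
  assumes B: "bounded_bilinear B" and "a \<le> b"
    and f: "weak_derivative_on a b f f'" and g: "weak_derivative_on a b g g'"
  shows "((\<lambda>t. B (f' t) (g t) + B (f t) (g' t)) has_integral (B (f b) (g b) - B (f a) (g a))) {a..b}"
proof -
  interpret bounded_bilinear B by fact
  define h where "h = (\<lambda>t. B (f' t) (g t) + B (f t) (g' t))"
  define n where "n = (\<lambda>t. norm (f' t) + norm (g' t))"
  define m where "m = (\<lambda>t. integral {a..t} n)"
  define H where "H = (\<lambda>t. B (f t) (g t) - integral {a..t} h)"
  obtain K where K: "K > 0" "\<And>x y. norm (B x y) \<le> norm x * norm y * K"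
    using pos_bounded by blast
  have int: "f' absolutely_integrable_on {a..b}" "g' absolutely_integrable_on {a..b}"
    using f g by (auto simp: weak_derivative_on_def)
  have "(\<lambda>t. B (f t) (g' t)) absolutely_integrable_on {a..b}"
    by (rule bounded_bilinear_absolutely_integrable[OF B weak_derivative_on_continuous[OF f] int(2)])
  moreover have "(\<lambda>t. B (f' t) (g t)) absolutely_integrable_on {a..b}"
    by (rule bounded_bilinear_absolutely_integrable[OF flip weak_derivative_on_continuous[OF g] int(1)])
  ultimately have "h absolutely_integrable_on {a..b}"
    unfolding h_def by (intro set_integral_add)
  then have h: "h integrable_on {a..b}"
    by (rule set_lebesgue_integral_eq_integral)
  have n: "n integrable_on {a..b}"
    unfolding n_def using int by (auto simp: absolutely_integrable_on_def intro!: integrable_add)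
  have n_sub: "n integrable_on {s..t}" and h_sub: "h integrable_on {s..t}" if "a \<le> s" "t \<le> b" for s t
    using n h that by (auto intro: integrable_subinterval_real)
  have m_diff: "m t - m s = integral {s..t} n" if "a \<le> s" "s \<le> t" "t \<le> b" for s t
    using Henstock_Kurzweil_Integration.integral_combine[of a s t n] n_sub[of a t] that
    by (simp add: m_def algebra_simps)
  have h_diff: "integral {a..t} h - integral {a..s} h = integral {s..t} h"
    if "a \<le> s" "s \<le> t" "t \<le> b" for s t
    using Henstock_Kurzweil_Integration.integral_combine[of a s t h] h_sub[of a t] that
    by (simp add: algebra_simps)
  \<comment> \<open>Stated for a generic \<open>k\<close> because it serves both \<open>f\<close>
    and \<open>g\<close>, whose types may differ. The enclosing \<open>{s..t}\<close> gives one
    bound for all \<open>u\<close> and \<open>v\<close> inside.\<close>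
  have increment: "norm (k v - k u) \<le> m t - m s"
    if k: "weak_derivative_on a b k k'" "\<And>x. norm (k' x) \<le> n x"
      and le: "a \<le> s" "s \<le> u" "u \<le> v" "v \<le> t" "t \<le> b"
    for s t u v and k k' :: "real \<Rightarrow> 'd::euclidean_space"
  proof -
    have hi: "(k' has_integral (k v - k u)) {u..v}"
      using weak_derivative_on_has_integral[OF k(1)] le by auto
    then have "norm (k v - k u) = norm (integral {u..v} k')"
      by (simp add: integral_unique)
    also have "\<dots> \<le> integral {u..v} n"
      using hi n_sub le k(2) by (intro Henstock_Kurzweil_Integration.integral_norm_bound_integral) auto
    also have "\<dots> \<le> integral {s..t} n"
      using n_sub le by (intro integral_subset_le) (auto simp: n_def)
    finally show ?thesis using m_diff le by simp
  qed
  have "H b = H a"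
  proof (rule eq_if_quadratic_increments[where C = K and m = m])
    show "continuous_on {a..b} m"
      unfolding m_def using n by (rule indefinite_integral_continuous_1)
    show "mono_on {a..b} m"
    proof (rule mono_onI)
      fix s t assume st: "s \<in> {a..b}" "t \<in> {a..b}" "s \<le> t"
      then have "0 \<le> integral {s..t} n"
        by (intro Henstock_Kurzweil_Integration.integral_nonneg n_sub) (auto simp: n_def)
      then show "m s \<le> m t"
        using m_diff st by fastforce
    qed
    fix s t assume st: "a \<le> s" "s \<le> t" "t \<le> b"
    let ?P = "m t - m s"
    \<comment> \<open>The increment of the product splits as
      \<open>B (f t - f s) (g t) + B (f s) (g t - g s)\<close>; each summand is the integral of a
      density with the other factor frozen at an endpoint.\<close>
    have "((\<lambda>u. B (f' u) (g t)) has_integral B (f t - f s) (g t)) {s..t}"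
      using has_integral_linear[OF weak_derivative_on_has_integral[OF f st] bounded_linear_left]
      by (simp add: o_def)
    moreover have "((\<lambda>u. B (f s) (g' u)) has_integral B (f s) (g t - g s)) {s..t}"
      using has_integral_linear[OF weak_derivative_on_has_integral[OF g st] bounded_linear_right]
      by (simp add: o_def)
    ultimately have "((\<lambda>u. B (f' u) (g t) + B (f s) (g' u) - h u) has_integral
        B (f t - f s) (g t) + B (f s) (g t - g s) - integral {s..t} h) {s..t}"
      using integrable_integral[OF h_sub] st
      by (intro has_integral_diff has_integral_add) auto
    moreover have "B (f t - f s) (g t) + B (f s) (g t - g s) - integral {s..t} h = H t - H s"
      using h_diff[OF st] by (simp add: H_def diff_left diff_right algebra_simps)
    ultimately have e: "((\<lambda>u. B (f' u) (g t) + B (f s) (g' u) - h u) has_integral (H t - H s)) {s..t}"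
      by simp
    \<comment> \<open>Compared with \<open>h\<close>, each frozen factor is off by at most
      \<open>?P\<close>; the integral of \<open>n\<close> supplies the second factor
      \<open>?P\<close>.\<close>
    have "norm (H t - H s) \<le> integral {s..t} (\<lambda>u. K * ?P * n u)"
      unfolding integral_unique[OF e, symmetric]
    proof (rule Henstock_Kurzweil_Integration.integral_norm_bound_integral)
      show "(\<lambda>u. B (f' u) (g t) + B (f s) (g' u) - h u) integrable_on {s..t}"
        using e by blast
      show "(\<lambda>u. K * ?P * n u) integrable_on {s..t}"
        using n_sub st by (intro integrable_on_mult_right) auto
      fix u assume u: "u \<in> {s..t}"
      have "norm (B (f' u) (g t - g u)) \<le> norm (f' u) * norm (g t - g u) * K"
        by (rule K)
      also have "\<dots> \<le> norm (f' u) * ?P * K"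
        using increment[OF g, of s u t t] u st K by (intro mult_right_mono mult_left_mono) (auto simp: n_def)
      finally have 1: "norm (B (f' u) (g t - g u)) \<le> norm (f' u) * ?P * K" .
      have "norm (B (f s - f u) (g' u)) \<le> norm (f s - f u) * norm (g' u) * K"
        by (rule K)
      also have "\<dots> \<le> ?P * norm (g' u) * K"
        using increment[OF f, of s s u t] u st K
        by (intro mult_right_mono) (auto simp: n_def norm_minus_commute)
      finally have 2: "norm (B (f s - f u) (g' u)) \<le> ?P * norm (g' u) * K" .
      have "B (f' u) (g t) + B (f s) (g' u) - h u = B (f' u) (g t - g u) + B (f s - f u) (g' u)"
        by (simp add: h_def diff_left diff_right)
      then have "norm (B (f' u) (g t) + B (f s) (g' u) - h u) \<le>
          norm (B (f' u) (g t - g u)) + norm (B (f s - f u) (g' u))"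
        by (simp add: norm_triangle_ineq)
      then show "norm (B (f' u) (g t) + B (f s) (g' u) - h u) \<le> K * ?P * n u"
        using 1 2 by (simp add: n_def algebra_simps)
    qed
    also have "\<dots> = K * ?P\<^sup>2"
      using m_diff[OF st] by (simp add: power2_eq_square)
    finally show "norm (H t - H s) \<le> K * ?P\<^sup>2" .
  qed fact
  then have "integral {a..b} h = B (f b) (g b) - B (f a) (g a)"
    by (simp add: H_def algebra_simps)
  then show ?thesis
    using integrable_integral[OF h] by (simp add: h_def)
qed

section \<open>Sobolev functions\<close>

lemma sobolev_cong:
  assumes "\<And>t. t \<in> {a..b} \<Longrightarrow> f t = g t"
  shows "sobolev k a b f \<longleftrightarrow> sobolev k a b g"
proof (cases k)
  case 0
  have "f absolutely_integrable_on {a..b} \<longleftrightarrow> g absolutely_integrable_on {a..b}"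
    by (rule set_integrable_cong) (use assms in auto)
  moreover have "(\<lambda>t. (norm (f t))\<^sup>2) absolutely_integrable_on {a..b} \<longleftrightarrow>
      (\<lambda>t. (norm (g t))\<^sup>2) absolutely_integrable_on {a..b}"
    by (rule set_integrable_cong) (use assms in auto)
  ultimately show ?thesis by (simp add: 0)
next
  case (Suc l)
  have "(\<forall>t\<in>{a..b}. (h has_integral (f t - f a)) {a..t}) \<longleftrightarrow>
      (\<forall>t\<in>{a..b}. (h has_integral (g t - g a)) {a..t})" for h
    using assms by (intro ball_cong refl) auto
  then show ?thesis by (simp add: Suc)
qed

text \<open>An operator bound for \<open>L\<close> settles the square-integrable base case; above it
  \<open>L\<close> passes through the integrals. It serves both the chain-rule factor in
  substitutions and the differentials of chart changes.\<close>

lemma sobolev_linear: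
  fixes L :: "'v::euclidean_space \<Rightarrow> 'w::euclidean_space"
  assumes "bounded_linear L" "sobolev k a b f"
  shows "sobolev k a b (\<lambda>t. L (f t))"
  using assms(2)
proof (induction k arbitrary: f)
  case 0
  interpret bounded_linear L by fact
  obtain K where K: "K > 0" "\<And>x. norm (L x) \<le> norm x * K"
    using pos_bounded by blast
  have Lf: "(\<lambda>t. L (f t)) absolutely_integrable_on {a..b}"
    using absolutely_integrable_linear[OF _ assms(1)] 0 by (auto simp: o_def)
  have "(\<lambda>t. (norm (L (f t)))\<^sup>2) absolutely_integrable_on {a..b}"
  proof (rule measurable_bounded_by_integrable_imp_absolutely_integrable)
    have "(\<lambda>t. L (f t)) \<in> borel_measurable (lebesgue_on {a..b})"
      using Lf absolutely_integrable_measurable[of "{a..b}" "\<lambda>t. L (f t)"] by auto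
    then show "(\<lambda>t. (norm (L (f t)))\<^sup>2) \<in> borel_measurable (lebesgue_on {a..b})"
      by measurable
    show "(\<lambda>t. K\<^sup>2 * (norm (f t))\<^sup>2) integrable_on {a..b}"
      using 0 by (intro integrable_on_mult_right) (auto dest: set_lebesgue_integral_eq_integral(1))
    show "norm ((norm (L (f t)))\<^sup>2) \<le> K\<^sup>2 * (norm (f t))\<^sup>2" for t
      using power_mono[OF K(2)[of "f t"], of 2] by (simp add: power_mult_distrib mult.commute)
  qed simp
  with Lf show ?case by simp
next
  case (Suc k)
  interpret bounded_linear L by fact
  obtain g where g: "sobolev k a b g" and hi: "\<And>t. t\<in>{a..b} \<Longrightarrow> (g has_integral (f t - f a)) {a..t}"
    using Suc by auto
  have "((\<lambda>t. L (g t)) has_integral (L (f t) - L (f a))) {a..t}" if "t \<in> {a..b}" for t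
    using has_integral_linear[OF hi[OF that] assms(1)] by (simp add: o_def diff)
  with Suc.IH[OF g] show ?case by auto
qed

lemma sobolev_const: "sobolev k a b (\<lambda>_. v)"
\<comment> \<open>The weak derivative of a constant is the constant 0, so the induction hypothesis
  is needed at another value.\<close>
proof (induction k arbitrary: v)
  case 0
  then show ?case by simp
next
  case (Suc k)
  have "((\<lambda>_. 0) has_integral v - v) {a..t}" for t
    by simp
  with Suc[of 0] show ?case by auto
qed

section \<open>Affine changes of variable\<close>

text \<open>The domain is written as an image so that one statement covers both signs of
  \<open>m\<close>; the reversed pieces of the degeneracies need \<open>m < 0\<close>.\<close>

lemma has_integral_affine_real:
  fixes f :: "real \<Rightarrow> 'v::euclidean_space"
  assumes "(f has_integral i) ((\<lambda>x. m * x + c) ` {a..b})" "m \<noteq> 0"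
  shows "((\<lambda>x. f (m * x + c)) has_integral (1 / \<bar>m\<bar>) *\<^sub>R i) {a..b}"
proof -
  obtain p q where pq: "(\<lambda>x. m * x + c) ` {a..b} = cbox p q"
    by (metis box_real(2) image_affinity_atLeastAtMost box_eq_empty(2))
  have "(\<lambda>x. (1 / m) *\<^sub>R x + - ((1 / m) *\<^sub>R c)) ` cbox p q = {a..b}"
    using assms(2) unfolding pq[symmetric] image_image by (simp add: field_simps)
  with has_integral_affinity[of f i p q m c] assms pq show ?thesis
    by simp
qed

lemma integrable_affine_real:
  fixes f :: "real \<Rightarrow> 'v::euclidean_space"
  assumes "f integrable_on {p..q}" "(\<lambda>x. m * x + c) ` {a..b} \<subseteq> {p..q}" "m \<noteq> 0"
  shows "(\<lambda>x. f (m * x + c)) integrable_on {a..b}"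
proof -
  have "f integrable_on ((\<lambda>x. m * x + c) ` {a..b})"
    using assms(1,2) by (auto simp: image_affinity_atLeastAtMost split: if_splits
        intro: integrable_subinterval_real)
  then obtain i where "(f has_integral i) ((\<lambda>x. m * x + c) ` {a..b})"
    by blast
  from has_integral_affine_real[OF this assms(3)] show ?thesis
    by blast
qed

lemma absolutely_integrable_affine_real:
  fixes f :: "real \<Rightarrow> 'v::euclidean_space"
  assumes "f absolutely_integrable_on {p..q}" "(\<lambda>x. m * x + c) ` {a..b} \<subseteq> {p..q}" "m \<noteq> 0"
  shows "(\<lambda>x. f (m * x + c)) absolutely_integrable_on {a..b}"
  using assms integrable_affine_real[of f p q m c a b]
    integrable_affine_real[where f = "\<lambda>x. norm (f x)" and p = p and q = q and m = m and c = c and a = a and b = b]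
  by (simp add: absolutely_integrable_on_def)

text \<open>Induction on the order by the chain rule: if \<open>g\<close> is the weak derivative of
  \<open>f\<close>, the new one is \<open>m *\<^sub>R g (m * x + c)\<close>.\<close>

lemma sobolev_affine:
  assumes "sobolev k p q f" "(\<lambda>x. m * x + c) ` {a..b} \<subseteq> {p..q}" "m \<noteq> 0"
  shows "sobolev k a b (\<lambda>x. f (m * x + c))"
  using assms(1)
proof (induction k arbitrary: f)
  case 0
  then show ?case
    using assms(2,3) absolutely_integrable_affine_real[where f = f and p = p and q = q]
      absolutely_integrable_affine_real[where f = "\<lambda>x. (norm (f x))\<^sup>2" and p = p and q = q]
    by simp
next
  case (Suc k)
  then obtain g where g: "sobolev k p q g" and hi: "\<And>t. t\<in>{p..q} \<Longrightarrow> (g has_integral (f t - f p)) {p..t}"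
    by auto
  have in_pq: "m * x + c \<in> {p..q}" if "x \<in> {a..b}" for x
    using assms(2) that by blast
  note incr = has_integral_increment[of p q g f, OF hi]
  have "sobolev k a b (\<lambda>x. m *\<^sub>R g (m * x + c))"
    by (rule sobolev_linear[OF bounded_linear_scaleR_right Suc.IH[OF g]])
  moreover have "((\<lambda>x. m *\<^sub>R g (m * x + c)) has_integral (f (m * t + c) - f (m * a + c))) {a..t}"
    if t: "t \<in> {a..b}" for t
  proof (cases "m > 0")
    case True
    have "m * a + c \<in> {p..q}" "m * t + c \<in> {p..q}"
      using in_pq t by (meson atLeastAtMost_iff order_refl order_trans)+
    then have "(g has_integral (f (m * t + c) - f (m * a + c))) ((\<lambda>x. m * x + c) ` {a..t})"
      using incr[of "m * a + c" "m * t + c"] True t by (auto simp: image_affinity_atLeastAtMost)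
    from has_integral_cmul[OF has_integral_affine_real[OF this assms(3)], of m] True show ?thesis
      by simp
  next
    case False
    have "m * a + c \<in> {p..q}" "m * t + c \<in> {p..q}"
      using in_pq t by (meson atLeastAtMost_iff order_refl order_trans)+
    \<comment> \<open>For negative \<open>m\<close> the image interval is traversed backwards and
      the increment of \<open>f\<close> changes sign; the factor
      \<open>m / \<bar>m\<bar> = -1\<close> undoes this.\<close>
    then have "(g has_integral (f (m * a + c) - f (m * t + c))) ((\<lambda>x. m * x + c) ` {a..t})"
      using incr[of "m * t + c" "m * a + c"] False assms(3) t
      by (auto simp: image_affinity_atLeastAtMost mult_le_cancel_left)
    from has_integral_cmul[OF has_integral_affine_real[OF this assms(3)], of m] False assms(3)
    show ?thesis by simp
  qed
  ultimately show ?case by auto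
qed

text \<open>Positive order gives continuity on a compact interval. Applied to the weak derivative in
  \<open>sobolev\<close>, this yields the integrability that \<open>weak_derivative_on\<close> asks
  for.\<close>

lemma sobolev_imp_absolutely_integrable:
  assumes "sobolev k a b f"
  shows "f absolutely_integrable_on {a..b}"
  using assms
proof (induction k arbitrary: f)
  case 0
  then show ?case by simp
next
  case (Suc k)
  then obtain g where "weak_derivative_on a b f g"
    by (auto simp: weak_derivative_on_def)
  from weak_derivative_on_continuous[OF this] show ?case
    by (rule absolutely_integrable_continuous_real)
qed

section \<open>Piecewise Sobolev functions\<close>

lemma pw_sobolev_eq:
  assumes "pw_sobolev r a b f" and eq: "\<And>t. t \<in> {a..b} \<Longrightarrow> g t = f t"
  shows "pw_sobolev r a b g"
proof -
  obtain S where S: "finite S"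
    "\<And>c d. a \<le> c \<Longrightarrow> c < d \<Longrightarrow> d \<le> b \<Longrightarrow> {c<..<d} \<inter> S = {} \<Longrightarrow> sobolev r c d f"
    using assms(1) by (auto simp: pw_sobolev_def)
  have "sobolev r c d g" if "a \<le> c" "c < d" "d \<le> b" "{c<..<d} \<inter> S = {}" for c d
    using S(2)[OF that] sobolev_cong[of c d g f r] eq that by auto
  moreover have "continuous_on {a..b} g"
    using assms continuous_on_cong[of "{a..b}" "{a..b}" g f] by (auto simp: pw_sobolev_def)
  ultimately show ?thesis
    unfolding pw_sobolev_def using S(1) by blast
qed

lemma pw_sobolev_subinterval:
  assumes "pw_sobolev r a b f" "a \<le> c" "d \<le> b"
  shows "pw_sobolev r c d f"
proof -
  obtain S where "finite S" "\<And>u v. a \<le> u \<Longrightarrow> u < v \<Longrightarrow> v \<le> b \<Longrightarrow> {u<..<v} \<inter> S = {} \<Longrightarrow> sobolev r u v f"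
    using assms(1) by (auto simp: pw_sobolev_def)
  moreover have "continuous_on {c..d} f"
    using assms by (auto simp: pw_sobolev_def intro: continuous_on_subset)
  ultimately show ?thesis
    using assms(2,3) unfolding pw_sobolev_def by (metis order_trans)
qed

lemma pw_sobolev_linear:
  fixes L :: "'v::euclidean_space \<Rightarrow> 'w::euclidean_space"
  assumes "bounded_linear L" "pw_sobolev r a b f"
  shows "pw_sobolev r a b (\<lambda>t. L (f t))"
proof -
  obtain S where "finite S"
    "\<And>c d. a \<le> c \<Longrightarrow> c < d \<Longrightarrow> d \<le> b \<Longrightarrow> {c<..<d} \<inter> S = {} \<Longrightarrow> sobolev r c d (\<lambda>t. L (f t))"
    using assms(2) sobolev_linear[OF assms(1)] unfolding pw_sobolev_def by metis
  moreover have "continuous_on {a..b} (\<lambda>t. L (f t))"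
    using assms by (auto simp: pw_sobolev_def intro: bounded_linear.continuous_on)
  ultimately show ?thesis
    unfolding pw_sobolev_def by blast
qed

lemma pw_sobolev_const: "pw_sobolev r a b (\<lambda>_. v)"
  unfolding pw_sobolev_def
  by (intro conjI continuous_on_const exI[of _ "{}"] finite.emptyI allI impI sobolev_const)

text \<open>The break points are pulled back along the substitution, whose injectivity keeps the
  preimage finite.\<close>

lemma pw_sobolev_affine:
  assumes "pw_sobolev r p q f" "(\<lambda>x. m * x + c) ` {a..b} \<subseteq> {p..q}" "m \<noteq> 0"
  shows "pw_sobolev r a b (\<lambda>x. f (m * x + c))"
proof -
  obtain S where S: "finite S"
    "\<And>u v. p \<le> u \<Longrightarrow> u < v \<Longrightarrow> v \<le> q \<Longrightarrow> {u<..<v} \<inter> S = {} \<Longrightarrow> sobolev r u v f"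
    using assms(1) by (auto simp: pw_sobolev_def)
  have "finite ((\<lambda>x. m * x + c) -` S)"
    using S(1) assms(3) by (intro finite_vimageI) (auto simp: inj_on_def)
  moreover have "sobolev r u v (\<lambda>x. f (m * x + c))"
    if uv: "a \<le> u" "u < v" "v \<le> b" "{u<..<v} \<inter> (\<lambda>x. m * x + c) -` S = {}" for u v
  proof -
    define s t where "s = min (m * u + c) (m * v + c)" and "t = max (m * u + c) (m * v + c)"
    have in_pq: "m * u + c \<in> {p..q}" "m * v + c \<in> {p..q}"
      using subsetD[OF assms(2) imageI, of u] subsetD[OF assms(2) imageI, of v] uv by auto
    have ne: "m * u + c \<noteq> m * v + c"
      using uv assms(3) by auto
    have img: "(\<lambda>x. m * x + c) ` {u..v} = {s..t}"
      using uv assms(3)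
      by (auto simp: image_affinity_atLeastAtMost s_def t_def min_def max_def mult_le_cancel_left)
    \<comment> \<open>A point strictly between \<open>s\<close> and \<open>t\<close> comes from an
      interior point, since \<open>u\<close> and \<open>v\<close> map to \<open>s\<close> and
      \<open>t\<close> in some order.\<close>
    have "y \<notin> S" if y: "s < y" "y < t" for y
    proof
      assume "y \<in> S"
      have "y \<in> (\<lambda>x. m * x + c) ` {u..v}"
        using img y by auto
      then obtain x where x: "x \<in> {u..v}" "y = m * x + c"
        by blast
      have "x \<noteq> u" "x \<noteq> v"
        using y x by (auto simp: s_def t_def)
      then show False
        using x uv(4) \<open>y \<in> S\<close> by force
    qed
    moreover have "s < t"
      using ne unfolding s_def t_def by linarith
    moreover have "p \<le> s" "t \<le> q"
      using in_pq by (auto simp: s_def t_def)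
    ultimately have "sobolev r s t f"
      by (intro S(2)) auto
    then show ?thesis
      by (rule sobolev_affine) (use img assms(3) in auto)
  qed
  moreover have "continuous_on {a..b} (\<lambda>x. f (m * x + c))"
  proof (rule continuous_on_compose2[OF _ _ assms(2)])
    show "continuous_on {p..q} f"
      using assms(1) by (simp add: pw_sobolev_def)
  qed (intro continuous_intros)
  ultimately show ?thesis
    unfolding pw_sobolev_def by blast
qed

text \<open>The junction becomes a further break point, so derivatives need not match there;
  continuity holds because \<open>f\<close> is continuous on both closed pieces.\<close>

lemma pw_sobolev_combine:
  assumes "pw_sobolev r a m f" "pw_sobolev r m b f" "a \<le> m" "m \<le> b"
  shows "pw_sobolev r a b f"
proof -
  obtain S T where S: "finite S"
    "\<And>u v. a \<le> u \<Longrightarrow> u < v \<Longrightarrow> v \<le> m \<Longrightarrow> {u<..<v} \<inter> S = {} \<Longrightarrow> sobolev r u v f"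
    and T: "finite T"
    "\<And>u v. m \<le> u \<Longrightarrow> u < v \<Longrightarrow> v \<le> b \<Longrightarrow> {u<..<v} \<inter> T = {} \<Longrightarrow> sobolev r u v f"
    using assms(1,2) unfolding pw_sobolev_def by metis
  have "sobolev r u v f"
    if "a \<le> u" "u < v" "v \<le> b" "{u<..<v} \<inter> (insert m (S \<union> T)) = {}" for u v
  proof (cases "v \<le> m")
    case True
    then show ?thesis using S(2) that by blast
  next
    case False
    moreover have "m \<notin> {u<..<v}"
      using that by blast
    ultimately have "m \<le> u"
      by auto
    then show ?thesis using T(2) that by blast
  qed
  moreover have "continuous_on ({a..m} \<union> {m..b}) f"
    using assms by (intro continuous_on_closed_Un) (auto simp: pw_sobolev_def)
  moreover have "{a..m} \<union> {m..b} = {a..b}"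
    using assms by auto
  ultimately show ?thesis
    unfolding pw_sobolev_def using S(1) T(1) by (metis finite_Un finite_insert)
qed

text \<open>Induction over the break points: the interval is cut at the one just inserted and the
  two densities are glued. On a piece without break points, \<open>1 \<le> r\<close> supplies the
  density.\<close>

lemma pw_sobolev_weak_derivative_on:
  assumes "pw_sobolev r a b f" "1 \<le> r" "a \<le> b"
  obtains f' where "weak_derivative_on a b f f'"
proof -
  obtain S where "finite S"
    and S: "\<And>u v. a \<le> u \<Longrightarrow> u < v \<Longrightarrow> v \<le> b \<Longrightarrow> {u<..<v} \<inter> S = {} \<Longrightarrow> sobolev r u v f"
    using assms(1) by (auto simp: pw_sobolev_def)
  from \<open>finite S\<close> S assms(3) have "\<exists>f'. weak_derivative_on a b f f'"
  proof (induction S arbitrary: a b rule: finite_induct)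
    case empty
    show ?case
    proof (cases "a < b")
      case True
      then have "sobolev (Suc (r - 1)) a b f"
        using empty.prems(1)[of a b] assms(2) by simp
      then show ?thesis
        unfolding weak_derivative_on_def sobolev.simps by (metis sobolev_imp_absolutely_integrable)
    next
      \<comment> \<open>Here \<open>a = b\<close>, so there is no subinterval with
        \<open>c < d\<close> to test, and the zero density works.\<close>
      case False
      with empty.prems have "weak_derivative_on a b f (\<lambda>_. 0)"
        by (auto simp: weak_derivative_on_def has_integral_refl)
      then show ?thesis by blast
    qed
  next
    case (insert s S)
    show ?case
    proof (cases "a < s \<and> s < b")
      case True
      have "\<exists>f'. weak_derivative_on a s f f'" "\<exists>f'. weak_derivative_on s b f f'"
        using True by (auto intro!: insert.IH insert.prems(1))
      then show ?thesis
        using weak_derivative_on_combine True by (metis less_imp_le)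
    next
      case False
      then show ?thesis
        using insert.prems(2) by (intro insert.IH insert.prems(1)) auto
    qed
  qed
  then show ?thesis using that by blast
qed

text \<open>The existence of some density makes the choice in \<open>weak_deriv\<close> meaningful;
  nothing else about the chosen density is used later.\<close>

lemma weak_deriv_weak_derivative_on:
  assumes "pw_sobolev r 0 1 f" "1 \<le> r"
  shows "weak_derivative_on 0 1 f (weak_deriv f)"
proof -
  have "\<exists>f'. weak_derivative_on 0 1 f f'"
    using pw_sobolev_weak_derivative_on[OF assms] by auto
  then have "weak_derivative_on 0 1 f (SOME g. weak_derivative_on 0 1 f g)"
    by (rule someI_ex)
  moreover have "weak_deriv f = (SOME g. weak_derivative_on 0 1 f g)"
    by (simp add: weak_deriv_def weak_derivative_on_def)
  ultimately show ?thesis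
    by simp
qed

section \<open>Tangent maps at the identity\<close>

text \<open>Linearization of \<open>sigma1\<close>: the piece at the group unit becomes the zero
  vector. \<open>sigma0\<close> mentions no unit, so it applies to vector-valued paths as it
  is.\<close>

definition sigma1_tangent :: "(real \<Rightarrow> 'v::zero) \<Rightarrow> real \<Rightarrow> 'v" where
  "sigma1_tangent \<alpha> \<tau> =
     (if \<tau> \<le> 1/3 then 0 else if \<tau> \<le> 2/3 then \<alpha> (3 * \<tau> - 1) else \<alpha> (3 - 3 * \<tau>))"

context lie_group
begin

section \<open>Preferred charts and differentials at the unit\<close>

lemma chart_at_in_atlas:
  assumes "p \<in> carrier G"
  shows "(fst (chart_at A p), coord A p) \<in> A" "p \<in> fst (chart_at A p)"
proof -
  have "p \<in> (\<Union>(U, \<phi>)\<in>A. U)"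
    using atlas assms topspace_eq by (simp add: smooth_atlas_def)
  then have "\<exists>c. c \<in> A \<and> p \<in> fst c"
    by force
  then have "chart_at A p \<in> A \<and> p \<in> fst (chart_at A p)"
    unfolding chart_at_def by (rule someI_ex)
  then show "(fst (chart_at A p), coord A p) \<in> A" "p \<in> fst (chart_at A p)"
    by (simp_all add: coord_def)
qed

lemma chart:
  assumes "(U, \<phi>) \<in> A"
  shows chart_subset: "U \<subseteq> carrier G" and open_chart_image: "open (\<phi> ` U)"
    and inj_on_chart: "inj_on \<phi> U"
proof -
  have U: "openin X U" "open (\<phi> ` U)" "homeomorphic_map (subtopology X U) (top_of_set (\<phi> ` U)) \<phi>"
    using atlas assms by (auto simp: smooth_atlas_def)
  show "U \<subseteq> carrier G" "open (\<phi> ` U)"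
    using U openin_subset topspace_eq by auto
  then show "inj_on \<phi> U"
    using homeomorphic_imp_injective_map[OF U(3)] topspace_eq by (simp add: Int_absorb1)
qed

lemma coord_coord_inv:
  assumes "y \<in> coord A p ` fst (chart_at A p)"
  shows "coord A p (coord_inv A p y) = y" "coord_inv A p y \<in> fst (chart_at A p)"
  using assms by (simp_all add: coord_inv_def f_inv_into_f inv_into_into)

lemma coord_inv_coord:
  assumes "p \<in> carrier G"
  shows "coord_inv A p (coord A p p) = p"
  using chart_at_in_atlas[OF assms] inj_on_chart by (simp add: coord_inv_def)

lemma coord_self_in_image:
  assumes "p \<in> carrier G"
  shows "coord A p p \<in> coord A p ` fst (chart_at A p)"
  using chart_at_in_atlas[OF assms] by simp

text \<open>In coordinates, translation by the unit is \<open>coord\<close> after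
  \<open>coord_inv\<close>. These cancel on the chart image, which is an open neighbourhood, and the
  derivative is local.\<close>

lemma left_triv_one: "left_triv G A \<one> v = v"
proof -
  let ?W = "coord A \<one> ` fst (chart_at A \<one>)"
  let ?f = "coord A (inv \<one> \<otimes> \<one>) \<circ> (\<lambda>x. inv \<one> \<otimes> x) \<circ> coord_inv A \<one>"
  have "(?f has_derivative (\<lambda>v. v)) (at (coord A \<one> \<one>))"
  proof (rule has_derivative_transform_within_open[of "\<lambda>x. x" _ _ _ ?W])
    show "open ?W"
      using open_chart_image chart_at_in_atlas(1) by blast
    show "coord A \<one> \<one> \<in> ?W"
      by (intro coord_self_in_image one_closed)
    fix y assume "y \<in> ?W"
    note y = coord_coord_inv[OF this]
    moreover have "coord_inv A \<one> y \<in> carrier G"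
      using y(2) chart_subset chart_at_in_atlas(1)[OF one_closed] by blast
    ultimately show "y = ?f y"
      by simp
  qed simp
  from frechet_derivative_at[OF this] show ?thesis
    unfolding left_triv_def tangent_map_def by metis
qed

text \<open>The line stays in the open chart image for small \<open>s\<close>, where the two maps
  cancel.\<close>

lemma vector_derivative_coord_line:
  assumes "p \<in> carrier G"
  shows "vector_derivative (\<lambda>s. coord A p (coord_inv A p (coord A p p + s *\<^sub>R v))) (at 0) = v"
proof (rule vector_derivative_at)
  let ?W = "coord A p ` fst (chart_at A p)"
  let ?l = "\<lambda>s. coord A p p + s *\<^sub>R v"
  show "((\<lambda>s. coord A p (coord_inv A p (?l s))) has_vector_derivative v) (at 0)"
  proof (rule has_vector_derivative_transform_within_open[of ?l _ _ "?l -` ?W"])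
    show "(?l has_vector_derivative v) (at 0)"
      by (auto intro!: derivative_eq_intros simp: has_vector_derivative_def)
    show "open (?l -` ?W)"
      using open_chart_image chart_at_in_atlas(1)[OF assms]
      by (intro open_vimage continuous_intros) auto
    show "0 \<in> ?l -` ?W"
      using coord_self_in_image[OF assms] by simp
    show "?l s = coord A p (coord_inv A p (?l s))" if "s \<in> ?l -` ?W" for s
      using coord_coord_inv(1)[of "?l s" p] that by simp
  qed
qed

text \<open>\<open>sigma0\<close> only reparametrizes, so it commutes with the pointwise chart map,
  and at each \<open>\<tau>\<close> a straight coordinate line is differentiated.\<close>

lemma path_tangent_map_sigma0: "path_tangent_map G A sigma0 \<alpha> = sigma0 \<alpha>"
proof
  fix \<tau>
  have "sigma0 (\<lambda>t. coord_inv A \<one> (coord A \<one> \<one> + s *\<^sub>R \<alpha> t)) \<tau> =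
      coord_inv A \<one> (coord A \<one> \<one> + s *\<^sub>R sigma0 \<alpha> \<tau>)" for s
    by (simp add: sigma0_def)
  then show "path_tangent_map G A sigma0 \<alpha> \<tau> = sigma0 \<alpha> \<tau>"
    by (simp add: path_tangent_map_def vector_derivative_coord_line)
qed

lemma path_tangent_map_sigma1: "path_tangent_map G A (sigma1 G) \<alpha> = sigma1_tangent \<alpha>"
proof
  fix \<tau>
  \<comment> \<open>Where \<open>sigma1\<close> takes the value \<open>\<one>\<close>, the
    coordinate line has velocity 0; \<open>coord_inv_coord\<close> identifies the two.\<close>
  have "sigma1 G (\<lambda>t. coord_inv A \<one> (coord A \<one> \<one> + s *\<^sub>R \<alpha> t)) \<tau> =
      coord_inv A \<one> (coord A \<one> \<one> + s *\<^sub>R sigma1_tangent \<alpha> \<tau>)" for s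
    by (simp add: sigma1_def sigma1_tangent_def coord_inv_coord)
  then show "path_tangent_map G A (sigma1 G) \<alpha> \<tau> = sigma1_tangent \<alpha> \<tau>"
    by (simp add: path_tangent_map_def vector_derivative_coord_line)
qed

section \<open>The Segal form at the constant loop\<close>

lemma const_loop_in_loop_group: "const_loop G \<in> loop_group G X A r"
proof -
  have "pw_sobolev r c d (\<phi> \<circ> const_loop G)" for c d and \<phi> :: "_ \<Rightarrow> 'b::euclidean_space"
    using pw_sobolev_const by (simp add: const_loop_def o_def)
  then show ?thesis
    using topspace_eq by (auto simp: loop_group_def path_group_def const_loop_def)
qed

text \<open>Smoothness of the atlas makes the chart change differentiable; its differential is the
  map by which \<open>loop_tangent_space\<close> tests regularity.\<close>

lemma bounded_linear_chart_transition_derivative: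
  assumes "(U, \<phi>) \<in> A" "p \<in> U"
  shows "bounded_linear (frechet_derivative (\<phi> \<circ> coord_inv A p) (at (coord A p p)))"
proof -
  have p: "p \<in> carrier G"
    using assms chart_subset by blast
  have "smooth_on (coord A p ` (fst (chart_at A p) \<inter> U)) (\<phi> \<circ> coord_inv A p)"
    using atlas assms(1) chart_at_in_atlas(1)[OF p]
    unfolding smooth_atlas_def coord_inv_def by fast
  then have "Ck_on (Suc 0) (coord A p ` (fst (chart_at A p) \<inter> U)) (\<phi> \<circ> coord_inv A p)"
    unfolding smooth_on_def by blast
  then have "(\<phi> \<circ> coord_inv A p) differentiable at (coord A p p)"
    using chart_at_in_atlas(2)[OF p] assms(2) by auto
  then show ?thesis
    using frechet_derivative_works has_derivative_bounded_linear by blast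
qed

text \<open>Along the constant loop the preferred chart never changes, so the regularity test is
  composition with one fixed bounded linear map.\<close>

lemma loop_tangent_space_const_loop:
  assumes "pw_sobolev r 0 1 a" "a 0 = 0" "a 1 = 0"
  shows "a \<in> loop_tangent_space A r (const_loop G)"
proof -
  have "pw_sobolev r c d (\<lambda>\<tau>. frechet_derivative (\<phi> \<circ> coord_inv A \<one>) (at (coord A \<one> \<one>)) (a \<tau>))"
    if "(U, \<phi>) \<in> A" "0 \<le> c" "c < d" "d \<le> 1" "const_loop G ` {c..d} \<subseteq> U" for U \<phi> c d
  proof -
    \<comment> \<open>The interval is nonempty by \<open>c < d\<close>, which puts the unit into
      \<open>U\<close>.\<close>
    have "const_loop G c \<in> U"
      using that by auto
    then have "\<one> \<in> U"
      by (simp add: const_loop_def)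
    then show ?thesis
      using pw_sobolev_linear[OF bounded_linear_chart_transition_derivative[OF that(1)]
          pw_sobolev_subinterval[OF assms(1)]] that by auto
  qed
  then show ?thesis
    using assms by (auto simp: loop_tangent_space_def const_loop_def)
qed

text \<open>The membership guards of \<open>segal_form\<close> hold, so its \<open>undefined\<close>
  branch is avoided, and \<open>left_triv_one\<close> removes the trivializations.\<close>

lemma segal_form_const_loop:
  assumes "pw_sobolev r 0 1 a" "a 0 = 0" "a 1 = 0" "pw_sobolev r 0 1 b" "b 0 = 0" "b 1 = 0"
  shows "segal_form G X A B r (const_loop G) a b = integral {0..1} (\<lambda>\<tau>. B (weak_deriv a \<tau>) (b \<tau>))"
  using loop_tangent_space_const_loop const_loop_in_loop_group assms
  by (simp add: segal_form_def) (simp add: const_loop_def left_triv_one)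

end

section \<open>The pairing of the two degeneracies\<close>

text \<open>Three affine reparametrizations, of slopes 3, 0 and -3, are joined at \<open>1/3\<close>
  and \<open>2/3\<close>.\<close>

lemma pw_sobolev_sigma0:
  assumes "pw_sobolev r 0 1 \<alpha>"
  shows "pw_sobolev r 0 1 (sigma0 \<alpha>)"
proof (rule pw_sobolev_combine[of _ _ "1/3"], goal_cases)
  case 1
  have "pw_sobolev r 0 (1/3) (\<lambda>\<tau>. \<alpha> (3 * \<tau> + 0))"
    by (rule pw_sobolev_affine[OF assms]) auto
  then show ?case
    by (rule pw_sobolev_eq) (auto simp: sigma0_def)
next
  case 2
  show ?case
  proof (rule pw_sobolev_combine[of _ _ "2/3"], goal_cases)
    case 1
    have "sigma0 \<alpha> \<tau> = \<alpha> 1" if "\<tau> \<in> {1/3..2/3}" for \<tau>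
    \<comment> \<open>At the left junction the definition selects the preceding branch, whose value
      \<open>\<alpha> (3 * (1/3))\<close> agrees.\<close>
    proof (cases "\<tau> = 1/3")
      case True
      show ?thesis unfolding True by (simp add: sigma0_def)
    qed (use that in \<open>auto simp: sigma0_def\<close>)
    with pw_sobolev_const show ?case
      by (rule pw_sobolev_eq)
  next
    case 2
    have "pw_sobolev r (2/3) 1 (\<lambda>\<tau>. \<alpha> (-3 * \<tau> + 3))"
      by (rule pw_sobolev_affine[OF assms]) auto
    moreover have "sigma0 \<alpha> \<tau> = \<alpha> (-3 * \<tau> + 3)" if "\<tau> \<in> {2/3..1}" for \<tau>
    proof (cases "\<tau> = 2/3")
      case True
      show ?thesis unfolding True by (simp add: sigma0_def)
    qed (use that in \<open>auto simp: sigma0_def\<close>)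
    ultimately show ?case
      by (rule pw_sobolev_eq)
  qed auto
qed auto

text \<open>Here \<open>\<alpha> 0 = 0\<close> gives continuity at \<open>1/3\<close>, where the
  zero piece meets the start of \<open>\<alpha>\<close>.\<close>

lemma pw_sobolev_sigma1_tangent:
  assumes "pw_sobolev r 0 1 \<alpha>" "\<alpha> 0 = 0"
  shows "pw_sobolev r 0 1 (sigma1_tangent \<alpha>)"
proof (rule pw_sobolev_combine[of _ _ "1/3"], goal_cases)
  case 1
  show ?case
    by (rule pw_sobolev_eq[OF pw_sobolev_const[where v = 0]]) (auto simp: sigma1_tangent_def)
next
  case 2
  show ?case
  proof (rule pw_sobolev_combine[of _ _ "2/3"], goal_cases)
    case 1
    have "pw_sobolev r (1/3) (2/3) (\<lambda>\<tau>. \<alpha> (3 * \<tau> + (-1)))"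
      by (rule pw_sobolev_affine[OF assms(1)]) auto
    moreover have "sigma1_tangent \<alpha> \<tau> = \<alpha> (3 * \<tau> + (-1))" if "\<tau> \<in> {1/3..2/3}" for \<tau>
    proof (cases "\<tau> = 1/3")
      case True
      show ?thesis unfolding True by (simp add: sigma1_tangent_def assms(2))
    qed (use that in \<open>auto simp: sigma1_tangent_def\<close>)
    ultimately show ?case
      by (rule pw_sobolev_eq)
  next
    case 2
    have "pw_sobolev r (2/3) 1 (\<lambda>\<tau>. \<alpha> (-3 * \<tau> + 3))"
      by (rule pw_sobolev_affine[OF assms(1)]) auto
    moreover have "sigma1_tangent \<alpha> \<tau> = \<alpha> (-3 * \<tau> + 3)" if "\<tau> \<in> {2/3..1}" for \<tau>
    proof (cases "\<tau> = 2/3")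
      case True
      show ?thesis unfolding True by (simp add: sigma1_tangent_def)
    qed (use that in \<open>auto simp: sigma1_tangent_def\<close>)
    ultimately show ?case
      by (rule pw_sobolev_eq)
  qed auto
qed auto

lemma integrable_bilinear_weak_derivative:
  fixes B :: "'a::euclidean_space \<Rightarrow> 'b::euclidean_space \<Rightarrow> 'c::euclidean_space"
  assumes "bounded_bilinear B" "weak_derivative_on a b f f'" "weak_derivative_on a b g g'"
  shows "(\<lambda>t. B (f' t) (g t)) integrable_on {a..b}"
proof -
  interpret bounded_bilinear B by fact
  have "(\<lambda>t. B (f' t) (g t)) absolutely_integrable_on {a..b}"
    by (rule bounded_bilinear_absolutely_integrable[OF flip weak_derivative_on_continuous[OF assms(3)]])
      (use assms(2) in \<open>simp add: weak_derivative_on_def\<close>)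
  then show ?thesis
    by (rule set_lebesgue_integral_eq_integral)
qed

text \<open>The last third is left as an integral, to be evaluated together with its counterpart in
  which \<open>\<alpha>\<close> and \<open>\<beta>\<close> are exchanged.\<close>

lemma integral_sigma1_sigma0:
  fixes \<alpha> \<beta> :: "real \<Rightarrow> 'v::euclidean_space" and B :: "'v \<Rightarrow> 'v \<Rightarrow> 'c::euclidean_space"
  assumes B: "bounded_bilinear B"
    and a: "weak_derivative_on 0 1 (sigma1_tangent \<alpha>) a'" and b: "weak_derivative_on 0 1 (sigma0 \<beta>) b'"
    and "\<alpha> 0 = 0"
  shows "integral {0..1} (\<lambda>\<tau>. B (a' \<tau>) (sigma0 \<beta> \<tau>)) =
    B (\<alpha> 1) (\<beta> 1) + integral {2/3..1} (\<lambda>\<tau>. B (a' \<tau>) (sigma1_tangent \<beta> \<tau>))"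
proof -
  interpret bounded_bilinear B by fact
  let ?h = "\<lambda>\<tau>. B (a' \<tau>) (sigma0 \<beta> \<tau>)"
  have "weak_derivative_on 0 (1/3) (sigma1_tangent \<alpha>) a'" "weak_derivative_on 0 (1/3) (sigma0 \<beta>) b'"
    using weak_derivative_on_subinterval[OF a] weak_derivative_on_subinterval[OF b] by simp_all
  \<comment> \<open>The density \<open>a'\<close> need not vanish pointwise on the first third.
    Integration by parts still gives 0: the boundary terms and the term with \<open>b'\<close>
    contain \<open>sigma1_tangent \<alpha>\<close>, which is 0 there.\<close>
  from integral_by_parts_weak_derivative[OF B _ this]
  have "((\<lambda>\<tau>. B (a' \<tau>) (sigma0 \<beta> \<tau>) + B (sigma1_tangent \<alpha> \<tau>) (b' \<tau>)) has_integral 0) {0..1/3}"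
    by (simp add: sigma1_tangent_def zero_left)
  then have 1: "(?h has_integral 0) {0..1/3}"
    by (rule has_integral_eq[rotated]) (simp add: sigma1_tangent_def zero_left)
  have "((\<lambda>\<tau>. B (a' \<tau>) (\<beta> 1)) has_integral B (sigma1_tangent \<alpha> (2/3) - sigma1_tangent \<alpha> (1/3)) (\<beta> 1)) {1/3..2/3}"
    using has_integral_linear[OF weak_derivative_on_has_integral[OF a, of "1/3" "2/3"] bounded_linear_left[of "\<beta> 1"]]
    by (simp add: o_def)
  then have "((\<lambda>\<tau>. B (a' \<tau>) (\<beta> 1)) has_integral B (\<alpha> 1) (\<beta> 1)) {1/3..2/3}"
    by (simp add: sigma1_tangent_def)
  then have 2: "(?h has_integral B (\<alpha> 1) (\<beta> 1)) {1/3..2/3}"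
    by (rule has_integral_spike_finite[of "{1/3}", rotated 2]) (auto simp: sigma0_def)
  have "?h integrable_on {2/3..1}"
    by (rule integrable_subinterval_real[OF integrable_bilinear_weak_derivative[OF B a b]]) auto
  then have "(?h has_integral integral {2/3..1} ?h) {2/3..1}"
    by blast
  \<comment> \<open>To the right of \<open>2/3\<close> both maps use the branch
    \<open>\<beta> (3 - 3 * \<tau>)\<close>.\<close>
  moreover have "integral {2/3..1} ?h = integral {2/3..1} (\<lambda>\<tau>. B (a' \<tau>) (sigma1_tangent \<beta> \<tau>))"
    by (rule integral_spike[of "{2/3}"]) (auto simp: sigma0_def sigma1_tangent_def)
  ultimately have 3: "(?h has_integral integral {2/3..1} (\<lambda>\<tau>. B (a' \<tau>) (sigma1_tangent \<beta> \<tau>))) {2/3..1}"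
    by simp
  have "(?h has_integral (0 + B (\<alpha> 1) (\<beta> 1) + integral {2/3..1} (\<lambda>\<tau>. B (a' \<tau>) (sigma1_tangent \<beta> \<tau>)))) {0..1}"
    by (rule has_integral_combine[OF _ _ has_integral_combine[OF _ _ 1 2] 3]) auto
  then show ?thesis
    by (simp add: integral_unique)
qed

theorem proposition5p2:
  fixes G :: "('g, 'x) monoid_scheme"
    and X :: "'g topology"
    and A :: "('g, 'v::euclidean_space) chart set"
    and B :: "'v \<Rightarrow> 'v \<Rightarrow> real"
    and r :: nat
  assumes "lie_group G X A"
    and "invariant_pairing G A B"
    and "1 \<le> r"
  shows "\<forall>\<alpha>\<in>path_algebra r. \<forall>\<beta>\<in>path_algebra r.
           van_est G A (segal_form G X A B r) \<alpha> \<beta> = B (ev1 \<alpha>) (ev1 \<beta>)"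
proof (intro ballI)
  fix \<alpha> \<beta> :: "real \<Rightarrow> 'v"
  assume "\<alpha> \<in> path_algebra r" "\<beta> \<in> path_algebra r"
  then have \<alpha>: "pw_sobolev r 0 1 \<alpha>" "\<alpha> 0 = 0" and \<beta>: "pw_sobolev r 0 1 \<beta>" "\<beta> 0 = 0"
    by (auto simp: path_algebra_def)
  interpret lie_group G X A by fact
  have B: "bounded_bilinear B" and sym: "\<And>a b. B a b = B b a"
    using assms(2) by (auto simp: invariant_pairing_def bilinear_conv_bounded_bilinear)
  let ?a = "sigma1_tangent \<alpha>" and ?b = "sigma1_tangent \<beta>"
  have s0: "sigma0 \<gamma> 0 = 0" "sigma0 \<gamma> 1 = 0" and s1: "sigma1_tangent \<gamma> 0 = 0" "sigma1_tangent \<gamma> 1 = 0"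
    if "\<gamma> 0 = 0" for \<gamma> :: "real \<Rightarrow> 'v"
    using that by (auto simp: sigma0_def sigma1_tangent_def)
  \<comment> \<open>Facts 1 and 2 concern \<open>sigma0\<close> of \<open>\<alpha>\<close> and
    \<open>\<beta>\<close>, facts 3 and 4 \<open>sigma1_tangent\<close>; \<open>wd\<close> and
    \<open>wd'\<close> keep this order.\<close>
  note pw = pw_sobolev_sigma0[OF \<alpha>(1)] pw_sobolev_sigma0[OF \<beta>(1)]
    pw_sobolev_sigma1_tangent[OF \<alpha>] pw_sobolev_sigma1_tangent[OF \<beta>]
  note wd = pw[THEN weak_deriv_weak_derivative_on, OF assms(3)]
  note wd' = wd[THEN weak_derivative_on_subinterval, of "2/3" 1, simplified]
  have "van_est G A (segal_form G X A B r) \<alpha> \<beta> =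
      integral {0..1} (\<lambda>\<tau>. B (weak_deriv ?a \<tau>) (sigma0 \<beta> \<tau>)) +
      integral {0..1} (\<lambda>\<tau>. B (weak_deriv ?b \<tau>) (sigma0 \<alpha> \<tau>))"
    unfolding van_est_def path_tangent_map_sigma0 path_tangent_map_sigma1
    by (simp add: segal_form_const_loop pw s0 s1 \<alpha>(2) \<beta>(2))
  also have "\<dots> = B (\<alpha> 1) (\<beta> 1) + B (\<beta> 1) (\<alpha> 1) +
      (integral {2/3..1} (\<lambda>\<tau>. B (weak_deriv ?a \<tau>) (?b \<tau>)) +
       integral {2/3..1} (\<lambda>\<tau>. B (weak_deriv ?b \<tau>) (?a \<tau>)))"
    using integral_sigma1_sigma0[OF B wd(3,2) \<alpha>(2)] integral_sigma1_sigma0[OF B wd(4,1) \<beta>(2)]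
    by simp
  also have "integral {2/3..1} (\<lambda>\<tau>. B (weak_deriv ?a \<tau>) (?b \<tau>)) +
       integral {2/3..1} (\<lambda>\<tau>. B (weak_deriv ?b \<tau>) (?a \<tau>)) =
      integral {2/3..1} (\<lambda>\<tau>. B (weak_deriv ?a \<tau>) (?b \<tau>) + B (weak_deriv ?b \<tau>) (?a \<tau>))"
    by (rule Henstock_Kurzweil_Integration.integral_add[symmetric])
      (rule integrable_bilinear_weak_derivative[OF B wd'(3,4)]
        integrable_bilinear_weak_derivative[OF B wd'(4,3)])+
  \<comment> \<open>Symmetry of \<open>B\<close> turns the second summand into the missing half of
    the product rule.\<close>
  also have "\<dots> = B (?a 1) (?b 1) - B (?a (2/3)) (?b (2/3))"
    using integral_by_parts_weak_derivative[OF B _ wd'(3,4)]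
    by (simp add: integral_unique sym[of "weak_deriv ?b _"])
  \<comment> \<open>Both paths vanish at 1 because \<open>\<alpha>\<close> and
    \<open>\<beta>\<close> start at 0; at \<open>2/3\<close> they take the values
    \<open>\<alpha> 1\<close> and \<open>\<beta> 1\<close>.\<close>
  also have "\<dots> = - B (\<alpha> 1) (\<beta> 1)"
    using s1[of \<alpha>] s1[of \<beta>] \<alpha>(2) \<beta>(2) bounded_bilinear.zero_left[OF B]
    by (simp add: sigma1_tangent_def)
  finally show "van_est G A (segal_form G X A B r) \<alpha> \<beta> = B (ev1 \<alpha>) (ev1 \<beta>)"
    using sym[of "\<beta> 1"] by (simp add: ev1_def)
qed

end
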